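(* Let $1\le k\le n+1$. The Schubert cells of the odd symplectic grassmannian $G_\omega(k,E)$ are the orbits of the Borel subgroup $B$ of $\mathrm{Sp}_{2n+1}$ acting on $G_\omega(k,E)$.
   Context: $E$ is a complex vector space of dimension $2n+1$ with a skew-form $\omega$ of rank $2n$, contained as a hyperplane in a complex vector space $\tilde E$ of dimension $2n+2$ with a symplectic form $\tilde\omega$ extending $\omega$. Fix a basis $\{e_0,\dots,e_{2n+1}\}$ of $\tilde E$ such that $E=\langle e_0,\dots,e_{2n}\rangle$ and, with $\bar\imath=2n+1-i$, $\tilde\omega(e_i,e_j)=0$ unless $j=\bar\imath$ and $\tilde\omega(e_i,e_{\bar\imath})=1$ for $0\le i\le n$. Put $F_i=\langle e_0,\dots,e_i\rangle$ for $0\le i\le 2n+1$. $\mathrm{Sp}_{2n+1}$ is the stabilizer of $\omega$ in $\mathrm{GL}(E)$ and $B$ is its Borel subgroup of elements that are upper triangular in the basis $\{e_0,\dots,e_{2n}\}$ (equivalently, preserving the flag $F_0\subset\cdots\subset F_{2n}$). $G_\omega(k,E)$ (resp. $G_{\tilde\omega}(k,\tilde E)$) is the variety of $k$-dimensional isotropic subspaces of $E$ (resp. $\tilde E$); $G_\omega(k,E)$ is identified with the subvariety of those $V\in G_{\tilde\omega}(k,\tilde E)$ with $V\subset E$. For a multi-index $I=(0\le i_1<\cdots<i_k\le 2n+1)$ such that for each $0\le i\le n$ at most one of $i,\bar\imath$ appears in $I$, the Schubert cell $C_I$ of $G_{\tilde\omega}(k,\tilde E)$ is the set of $V\in G_{\tilde\omega}(k,\tilde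 E)$ with $\dim(V\cap F_i)=\#\{\alpha\mid i_\alpha\le i\}$ for all $0\le i\le 2n+1$. $G_\omega(k,E)$ is a union of such cells, and the Schubert cells of $G_\omega(k,E)$ are by definition the Schubert cells of $G_{\tilde\omega}(k,\tilde E)$ contained in it (namely those $C_I$ with $i_k\le 2n$). *)

theory Defs
  imports Complex_Main "HOL-Algebra.Group_Action"
begin

locale complex_vector_space = vector_space scale
  for scale :: "complex \<Rightarrow> 'v::ab_group_add \<Rightarrow> 'v"  (infixr \<open>*s\<close> 75)
begin

definition linear_form_on :: "'v set \<Rightarrow> ('v \<Rightarrow> complex) \<Rightarrow> bool" where
  "linear_form_on S f \<longleftrightarrow>
     (\<forall>x\<in>S. \<forall>y\<in>S. f (x + y) = f x + f y) \<and> (\<forall>c. \<forall>x\<in>S. f (c *s x) = c * f x)"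

definition linear_map_on :: "'v set \<Rightarrow> ('v \<Rightarrow> 'v) \<Rightarrow> bool" where
  "linear_map_on S f \<longleftrightarrow>
     (\<forall>x\<in>S. \<forall>y\<in>S. f (x + y) = f x + f y) \<and> (\<forall>c. \<forall>x\<in>S. f (c *s x) = c *s f x)"

text \<open>Forms on a subspace \<open>S\<close> are total functions whose values outside \<open>S\<close> are irrelevant.\<close>

definition skew_form_on :: "'v set \<Rightarrow> ('v \<Rightarrow> 'v \<Rightarrow> complex) \<Rightarrow> bool" where
  "skew_form_on S \<beta> \<longleftrightarrow>
     (\<forall>x\<in>S. linear_form_on S (\<beta> x)) \<and> (\<forall>y\<in>S. linear_form_on S (\<lambda>x. \<beta> x y)) \<and>
     (\<forall>x\<in>S. \<forall>y\<in>S. \<beta> x y = - \<beta> y x)"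

definition form_kernel :: "'v set \<Rightarrow> ('v \<Rightarrow> 'v \<Rightarrow> complex) \<Rightarrow> 'v set" where
  "form_kernel S \<beta> = {x\<in>S. \<forall>y\<in>S. \<beta> x y = 0}"

text \<open>
  The rank of \<open>x \<mapsto> \<beta> x \<cdot>\<close> from \<open>S\<close> to its dual, by rank-nullity for finite-dimensional \<open>S\<close>.
\<close>

definition form_rank :: "'v set \<Rightarrow> ('v \<Rightarrow> 'v \<Rightarrow> complex) \<Rightarrow> nat" where
  "form_rank S \<beta> = dim S - dim (form_kernel S \<beta>)"

definition symplectic_form_on :: "'v set \<Rightarrow> ('v \<Rightarrow> 'v \<Rightarrow> complex) \<Rightarrow> bool" where
  "symplectic_form_on S \<beta> \<longleftrightarrow> skew_form_on S \<beta> \<and> form_kernel S \<beta> = {0}"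

definition isotropic_grassmannian :: "('v \<Rightarrow> 'v \<Rightarrow> complex) \<Rightarrow> nat \<Rightarrow> 'v set \<Rightarrow> 'v set set" where
  "isotropic_grassmannian \<beta> k S =
     {V. subspace V \<and> V \<subseteq> S \<and> dim V = k \<and> (\<forall>x\<in>V. \<forall>y\<in>V. \<beta> x y = 0)}"

text \<open>
  Elements are extensional on \<open>S\<close> (undefined outside \<open>S\<close>), as in \<^const>\<open>BijGroup\<close>, whose
  composition and unit are used.
\<close>

definition GL_on :: "'v set \<Rightarrow> ('v \<Rightarrow> 'v) monoid" where
  "GL_on S = (BijGroup S)\<lparr>carrier := {g \<in> Bij S. linear_map_on S g}\<rparr>"

definition Sp_on :: "'v set \<Rightarrow> ('v \<Rightarrow> 'v \<Rightarrow> complex) \<Rightarrow> ('v \<Rightarrow> 'v) monoid" where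
  "Sp_on S \<beta> = (GL_on S)\<lparr>carrier :=
     {g \<in> carrier (GL_on S). \<forall>x\<in>S. \<forall>y\<in>S. \<beta> (g x) (g y) = \<beta> x y}\<rparr>"

end

text \<open>
  The ambient symplectic space is the whole type \<open>'v\<close>, and \<open>E\<close> is a hyperplane in it; only
  the values \<open>e 0, \<dots>, e (2 * n + 1)\<close> of \<open>e\<close> matter. Since both dimensions are positive,
  the conditions on \<^const>\<open>vector_space.dim\<close> entail finite-dimensionality.
\<close>

locale odd_symplectic = complex_vector_space scale
  for scale :: "complex \<Rightarrow> 'v::ab_group_add \<Rightarrow> 'v" +
  fixes n :: nat
    and E :: "'v set"
    and \<omega> :: "'v \<Rightarrow> 'v \<Rightarrow> complex"
    and \<omega>' :: "'v \<Rightarrow> 'v \<Rightarrow> complex"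
    and e :: "nat \<Rightarrow> 'v"
  assumes dim_ambient: "dim (UNIV :: 'v set) = 2 * n + 2"
    and symplectic: "symplectic_form_on UNIV \<omega>'"
    and subspace_E: "subspace E"
    and dim_E: "dim E = 2 * n + 1"
    and skew: "skew_form_on E \<omega>"
    and rank: "form_rank E \<omega> = 2 * n"
    and extends: "\<And>x y. x \<in> E \<Longrightarrow> y \<in> E \<Longrightarrow> \<omega>' x y = \<omega> x y"
    and inj_e: "inj_on e {0..2 * n + 1}"
    and independent_e: "independent (e ` {0..2 * n + 1})"
    and span_e: "span (e ` {0..2 * n + 1}) = UNIV"
    and E_eq: "E = span (e ` {0..2 * n})"
    and form_e_zero:
      "\<And>i j. i \<le> 2 * n + 1 \<Longrightarrow> j \<le> 2 * n + 1 \<Longrightarrow> j \<noteq> 2 * n + 1 - i \<Longrightarrow> \<omega>' (e i) (e j) = 0"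
    and form_e_one: "\<And>i. i \<le> n \<Longrightarrow> \<omega>' (e i) (e (2 * n + 1 - i)) = 1"
begin

definition F :: "nat \<Rightarrow> 'v set" where
  "F i = span (e ` {0..i})"

text \<open>
  The matrix of \<open>g\<close> in the basis \<open>e 0, \<dots>, e (2 * n)\<close> of \<open>E\<close> has the \<open>i\<close>-th coordinate of
  \<open>g (e j)\<close> as its entry in row \<open>i\<close> and column \<open>j\<close>.
\<close>

definition borel :: "('v \<Rightarrow> 'v) monoid" where
  "borel = (Sp_on E \<omega>)\<lparr>carrier := {g \<in> carrier (Sp_on E \<omega>).
     \<forall>i\<le>2 * n. \<forall>j<i. representation (e ` {0..2 * n}) (g (e j)) (e i) = 0}\<rparr>"

definition act :: "nat \<Rightarrow> ('v \<Rightarrow> 'v) \<Rightarrow> 'v set \<Rightarrow> 'v set" where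
  "act k g = (\<lambda>V\<in>isotropic_grassmannian \<omega> k E. g ` V)"

text \<open>
  A strictly increasing sequence \<open>i\<^sub>1 < \<dots> < i\<^sub>k\<close> is encoded as its set of entries, so that
  the number of indices \<open>\<alpha>\<close> with \<open>i\<^sub>\<alpha> \<le> i\<close> is the number of elements of that set below \<open>i\<close>.
\<close>

definition admissible :: "nat \<Rightarrow> nat set \<Rightarrow> bool" where
  "admissible k I \<longleftrightarrow> I \<subseteq> {0..2 * n + 1} \<and> card I = k \<and>
     (\<forall>i\<le>n. \<not> (i \<in> I \<and> 2 * n + 1 - i \<in> I))"

definition schubert_cell :: "nat \<Rightarrow> nat set \<Rightarrow> 'v set set" where
  "schubert_cell k I = {V \<in> isotropic_grassmannian \<omega>' k UNIV.
     \<forall>i\<le>2 * n + 1. dim (V \<inter> F i) = card {j \<in> I. j \<le> i}}"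

definition odd_schubert_cells :: "nat \<Rightarrow> 'v set set set" where
  "odd_schubert_cells k =
     {C. (\<exists>I. admissible k I \<and> C = schubert_cell k I) \<and> C \<subseteq> isotropic_grassmannian \<omega> k E}"

end

end

theory Submission
  imports Defs
begin

text \<open>
  A \<open>k\<close>-dimensional subspace \<open>V\<close> meets the flag with jumps exactly at its leading positions: the
  indices \<open>i\<close> for which some vector of \<open>V\<close> has last nonzero coordinate at \<open>i\<close>. So the Schubert
  cell \<open>C\<^sub>I\<close> consists of the isotropic \<open>V\<close> whose set of leading positions is \<open>I\<close>
  (\<open>schubert_cell_eq\<close>), and the claim becomes: two isotropic subspaces of \<open>E\<close> lie in one \<open>B\<close>-orbit
  iff they have the same leading positions. One direction is immediate, since elements of \<open>B\<close>
  preserve the flag (\<open>borel_image\<close>).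

  For the other direction it suffices to carry the coordinate subspace \<open>\<langle>e\<^sub>i | i \<in> I\<rangle>\<close> onto a
  given \<open>V\<close> with leading positions \<open>I\<close> by an upper triangular isometry of the symplectic space
  (\<open>coordinate_subspace_transport\<close>); two such isometries combine to one carrying \<open>V\<close> to \<open>W\<close>, and
  its restriction to the hyperplane \<open>E\<close> is in \<open>B\<close>.

  Write \<open>i* = 2 n + 1 - i\<close>. Gauss elimination gives a basis of \<open>V\<close> in reduced echelon form,
  \<open>v\<^sub>i = e\<^sub>i + w\<^sub>i\<close> with \<open>i \<in> I\<close>, where \<open>w\<^sub>i\<close> involves only \<open>e\<^sub>j\<close> with \<open>j < i\<close> and \<open>j \<notin> I\<close>. Then the
  family
    \<^item> \<open>f\<^sub>j = v\<^sub>j\<close> for \<open>j \<in> I\<close>,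
    \<^item> \<open>f\<^sub>j = e\<^sub>j - (\<Sum>i\<in>I. \<omega>'(e\<^sub>j, w\<^sub>i) / \<omega>'(e\<^bsub>i*\<^esub>, e\<^sub>i) \<cdot> e\<^bsub>i*\<^esub>)\<close> for \<open>j \<notin> I\<close>

  has the same Gram matrix as the basis \<open>e\<close>. Indeed \<open>\<omega>'(e\<^bsub>i*\<^esub>, v\<^sub>l)\<close> vanishes for \<open>l \<noteq> i\<close> because the
  echelon basis is reduced, so the \<open>i\<close>-th summand of the correction repairs the pairing of \<open>e\<^sub>j\<close> with
  \<open>v\<^sub>i\<close> alone. The pairings among the indices outside \<open>I\<close> are undisturbed, because \<open>e\<^bsub>i*\<^esub>\<close> pairs
  only with \<open>e\<^sub>i\<close> and isotropy of \<open>V\<close> puts \<open>i*\<close> outside \<open>I\<close>. The correction is triangular since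
  \<open>\<omega>'(e\<^sub>j, w\<^sub>i) \<noteq> 0\<close> forces \<open>j* < i\<close>, that is \<open>i* < j\<close>. Hence \<open>e\<^sub>j \<mapsto> f\<^sub>j\<close> is the required isometry.
\<close>

context odd_symplectic
begin

abbreviation lin :: "('v \<Rightarrow> 'v) \<Rightarrow> bool" where
  "lin T \<equiv> Vector_Spaces.linear scale scale T"

sublocale finite_dimensional_vector_space scale "e ` {0..2 * n + 1}"
  by unfold_locales (use independent_e span_e in auto)

sublocale endo: finite_dimensional_vector_space_pair scale "e ` {0..2 * n + 1}" scale "e ` {0..2 * n + 1}" ..

section \<open>Coordinates\<close>

definition coord :: "'v \<Rightarrow> nat \<Rightarrow> complex" where
  "coord v i = representation (e ` {0..2 * n + 1}) v (e i)"

lemma coord_add: "coord (x + y) i = coord x i + coord y i"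
  unfolding coord_def by (subst representation_add) (use independent_e span_e in auto)

lemma coord_scale: "coord (scale c x) i = c * coord x i"
  unfolding coord_def by (subst representation_scale) (use independent_e span_e in auto)

lemma coord_diff: "coord (x - y) i = coord x i - coord y i"
  unfolding coord_def by (subst representation_diff) (use independent_e span_e in auto)

lemma coord_zero [simp]: "coord 0 i = 0"
  unfolding coord_def by (simp add: representation_zero)

lemma coord_e: "i \<le> 2 * n + 1 \<Longrightarrow> j \<le> 2 * n + 1 \<Longrightarrow> coord (e i) j = (if i = j then 1 else 0)"
  unfolding coord_def using inj_e
  by (subst representation_basis[OF independent_e]) (auto simp: inj_on_eq_iff)

lemma coord_expansion: "x = (\<Sum>i\<le>2 * n + 1. scale (coord x i) (e i))"
proof -
  have "(\<Sum>b\<in>e ` {0..2 * n + 1}. scale (representation (e ` {0..2 * n + 1}) x b) b) = x"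
    by (rule sum_representation_eq) (use independent_e span_e in auto)
  then show ?thesis
    by (subst (asm) sum.reindex[OF inj_e]) (simp add: coord_def atLeast0AtMost)
qed

lemma coord_eqI: "(\<And>i. i \<le> 2 * n + 1 \<Longrightarrow> coord x i = coord y i) \<Longrightarrow> x = y"
  by (subst coord_expansion[of x], subst coord_expansion[of y]) simp

lemma in_span_e_iff:
  assumes "I \<subseteq> {0..2 * n + 1}"
  shows "x \<in> span (e ` I) \<longleftrightarrow> (\<forall>i\<le>2 * n + 1. i \<notin> I \<longrightarrow> coord x i = 0)"
proof
  assume "x \<in> span (e ` I)"
  then show "\<forall>i\<le>2 * n + 1. i \<notin> I \<longrightarrow> coord x i = 0"
  proof (induction rule: span_induct_alt)
    case (step c y z)
    then obtain a where "a \<in> I" "a \<le> 2 * n + 1" "y = e a" using assms by auto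
    then show ?case using assms step by (auto simp: coord_add coord_scale coord_e)
  qed simp
next
  assume *: "\<forall>i\<le>2 * n + 1. i \<notin> I \<longrightarrow> coord x i = 0"
  have "(\<Sum>i\<le>2 * n + 1. scale (coord x i) (e i)) \<in> span (e ` I)"
  proof (rule span_sum)
    fix i assume "i \<in> {..2 * n + 1}"
    then show "scale (coord x i) (e i) \<in> span (e ` I)"
      using * by (cases "i \<in> I") (auto intro: span_scale span_base span_zero)
  qed
  then show "x \<in> span (e ` I)" by (subst coord_expansion)
qed

lemma coord_hyperplane:
  assumes "x \<in> E"
  shows "representation (e ` {0..2 * n}) x (e i) = coord x i"
proof -
  have "representation (e ` {0..2 * n + 1}) x = representation (e ` {0..2 * n}) x"
    by (rule representation_extend) (use independent_e assms E_eq in auto)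
  then show ?thesis by (simp add: coord_def)
qed

text \<open>
  The flag shifted by one, \<open>lower (Suc i) = F i\<close>, so that \<open>lower 0\<close> is the zero space and inductions
  along the flag start there.
\<close>

definition lower :: "nat \<Rightarrow> 'v set" where
  "lower m = {v. \<forall>j\<le>2 * n + 1. m \<le> j \<longrightarrow> coord v j = 0}"

lemma subspace_lower: "subspace (lower m)"
  unfolding subspace_def lower_def by (auto simp: coord_add coord_scale)

lemma lower_mono: "m \<le> m' \<Longrightarrow> lower m \<subseteq> lower m'"
  unfolding lower_def by auto

lemma lower_0: "lower 0 = {0}"
  unfolding lower_def by (auto intro: coord_eqI)

lemma lower_UNIV: "2 * n + 2 \<le> m \<Longrightarrow> lower m = UNIV"
  unfolding lower_def by auto

lemma lower_Suc_iff: "i \<le> 2 * n + 1 \<Longrightarrow> x \<in> lower i \<longleftrightarrow> x \<in> lower (Suc i) \<and> coord x i = 0"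
  unfolding lower_def using Suc_le_eq le_neq_implies_less by (auto simp: le_less Suc_le_eq)

lemma F_eq_lower: "i \<le> 2 * n + 1 \<Longrightarrow> F i = lower (Suc i)"
  unfolding F_def lower_def by (auto simp: in_span_e_iff)

lemma E_eq_lower: "E = lower (2 * n + 1)"
  unfolding E_eq lower_def by (auto simp: in_span_e_iff le_Suc_eq)

lemma e_in_lower: "j \<le> 2 * n + 1 \<Longrightarrow> e j \<in> lower (Suc j)"
  unfolding lower_def by (auto simp: coord_e)

section \<open>The symplectic form in coordinates\<close>

lemma form_add: "\<omega>' (x + y) z = \<omega>' x z + \<omega>' y z" "\<omega>' z (x + y) = \<omega>' z x + \<omega>' z y"
  and form_scale: "\<omega>' (scale c x) z = c * \<omega>' x z" "\<omega>' z (scale c x) = c * \<omega>' z x"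
  and form_skew: "\<omega>' x z = - \<omega>' z x"
  using symplectic unfolding symplectic_form_on_def skew_form_on_def linear_form_on_def by blast+

lemma form_zero [simp]: "\<omega>' 0 z = 0" "\<omega>' z 0 = 0"
  using form_scale(1)[of 0 0 z] form_scale(2)[of z 0 0] by auto

lemma form_diff: "\<omega>' (x - y) z = \<omega>' x z - \<omega>' y z" "\<omega>' z (x - y) = \<omega>' z x - \<omega>' z y"
  using form_add(1)[of "x - y" y z] form_add(2)[of z "x - y" y] by auto

lemma form_sum: "\<omega>' (\<Sum>a\<in>A. f a) z = (\<Sum>a\<in>A. \<omega>' (f a) z)"
  "\<omega>' z (\<Sum>a\<in>A. f a) = (\<Sum>a\<in>A. \<omega>' z (f a))"
  by (induction A rule: infinite_finite_induct) (auto simp: form_add)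

lemma form_nondegenerate: "(\<And>y. \<omega>' x y = 0) \<Longrightarrow> x = 0"
  using symplectic unfolding symplectic_form_on_def form_kernel_def by auto

definition dual :: "nat \<Rightarrow> nat" where
  "dual i = 2 * n + 1 - i"

lemma dual_le: "dual i \<le> 2 * n + 1"
  by (simp add: dual_def)

lemmas dual_le_Suc [simp] = dual_le[simplified]

lemma dual_dual [simp]: "i \<le> 2 * n + 1 \<Longrightarrow> dual (dual i) = i"
  by (simp add: dual_def)

lemma form_e_eq_0: "i \<le> 2 * n + 1 \<Longrightarrow> j \<le> 2 * n + 1 \<Longrightarrow> j \<noteq> dual i \<Longrightarrow> \<omega>' (e i) (e j) = 0"
  by (rule form_e_zero) (auto simp: dual_def)

lemma form_e_dual_nonzero: "i \<le> 2 * n + 1 \<Longrightarrow> \<omega>' (e i) (e (dual i)) \<noteq> 0"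
  using form_e_one[of i] form_e_one[of "dual i"] form_skew[of "e i" "e (dual i)"]
  by (cases "i \<le> n") (auto simp: dual_def)

lemma form_e_left:
  assumes "i \<le> 2 * n + 1"
  shows "\<omega>' (e i) x = coord x (dual i) * \<omega>' (e i) (e (dual i))"
proof -
  have "\<omega>' (e i) x = (\<Sum>j\<le>2 * n + 1. coord x j * \<omega>' (e i) (e j))"
    by (subst coord_expansion[of x]) (simp only: form_sum form_scale)
  also have "\<dots> = (\<Sum>j\<le>2 * n + 1. if j = dual i then coord x j * \<omega>' (e i) (e j) else 0)"
    by (rule sum.cong) (use assms form_e_eq_0 in auto)
  finally show ?thesis by (simp del: sum.atMost_Suc)
qed

text \<open>
  A summand \<open>j < i\<close> needs a coordinate of \<open>y\<close> beyond its last one, a summand \<open>j > i\<close> needs a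
  coordinate of \<open>x\<close> beyond its last one.
\<close>

lemma form_leading:
  assumes "i \<le> 2 * n + 1" "x \<in> lower (Suc i)" "y \<in> lower (Suc (dual i))"
  shows "\<omega>' x y = coord x i * coord y (dual i) * \<omega>' (e i) (e (dual i))"
proof -
  have "\<omega>' x y = (\<Sum>j\<le>2 * n + 1. coord x j * \<omega>' (e j) y)"
    by (subst coord_expansion[of x]) (simp only: form_sum form_scale)
  also have "\<dots> = (\<Sum>j\<le>2 * n + 1. if j = i then coord x j * \<omega>' (e j) y else 0)"
  proof (rule sum.cong)
    fix j assume "j \<in> {..2 * n + 1}"
    then have j: "j \<le> 2 * n + 1" by simp
    consider "j = i" | "j < i" | "i < j" by linarith
    then show "coord x j * \<omega>' (e j) y = (if j = i then coord x j * \<omega>' (e j) y else 0)"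
    proof cases
      case 2
      then have "coord y (dual j) = 0" using assms j unfolding lower_def dual_def by auto
      then show ?thesis using 2 form_e_left[OF j, of y] by simp
    next
      case 3
      then have "coord x j = 0" using assms j unfolding lower_def by auto
      then show ?thesis using 3 by simp
    qed simp
  qed simp
  finally show ?thesis using assms form_e_left[of i y] by (simp del: sum.atMost_Suc)
qed

section \<open>Leading positions of a subspace\<close>

definition leading :: "'v set \<Rightarrow> nat set" where
  "leading V = {i \<in> {0..2 * n + 1}. \<not> V \<inter> lower (Suc i) \<subseteq> lower i}"

lemma leading_subset: "leading V \<subseteq> {0..2 * n + 1}"
  unfolding leading_def by auto

lemma leading_le: "i \<in> leading V \<Longrightarrow> i \<le> 2 * n + 1"
  unfolding leading_def by auto

lemma finite_leading: "finite (leading V)"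
  using leading_subset finite_subset by blast

lemma leading_vector:
  assumes "subspace V" "i \<in> leading V"
  obtains v where "v \<in> V" "v \<in> lower (Suc i)" "coord v i = 1"
proof -
  obtain u where u: "u \<in> V" "u \<in> lower (Suc i)" "coord u i \<noteq> 0"
    using assms(2) lower_Suc_iff unfolding leading_def by auto
  show thesis
  proof (rule that[of "scale (1 / coord u i) u"])
    show "scale (1 / coord u i) u \<in> V" "scale (1 / coord u i) u \<in> lower (Suc i)"
      using u assms(1) subspace_lower by (auto intro: subspace_scale)
    show "coord (scale (1 / coord u i) u) i = 1" using u by (simp add: coord_scale)
  qed
qed

text \<open>
  Passing from \<open>lower m\<close> to \<open>lower (Suc m)\<close> imposes one linear condition less, so the dimension of
  the intersection grows by at most one, and it grows exactly at the leading positions.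
\<close>

lemma dim_inter_lower:
  assumes "subspace V" "m \<le> 2 * n + 2"
  shows "dim (V \<inter> lower m) = card {i \<in> leading V. i < m}"
  using assms(2)
proof (induction m)
  case 0
  have "V \<inter> lower 0 = {0}" using assms(1) lower_0 subspace_0 by auto
  then show ?case using dim_unique[of "{}" "{0}" 0] by simp
next
  case (Suc m)
  show ?case
  proof (cases "m \<in> leading V")
    case False
    then have "V \<inter> lower (Suc m) = V \<inter> lower m"
      using Suc.prems lower_mono[of m "Suc m"] unfolding leading_def by auto
    moreover have "{i \<in> leading V. i < Suc m} = {i \<in> leading V. i < m}"
      using False by (auto simp: less_Suc_eq)
    ultimately show ?thesis using Suc by simp
  next
    case True
    obtain u where u: "u \<in> V" "u \<in> lower (Suc m)" "coord u m = 1"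
      using leading_vector[OF assms(1) True] .
    have m: "m \<le> 2 * n + 1" using Suc.prems by simp
    have sub: "subspace (V \<inter> lower k)" for k
      using assms(1) subspace_lower by (rule subspace_inter)
    have "span (insert u (V \<inter> lower m)) = V \<inter> lower (Suc m)"
    proof (rule antisym)
      show "span (insert u (V \<inter> lower m)) \<subseteq> V \<inter> lower (Suc m)"
        by (rule span_minimal) (use u lower_mono[of m "Suc m"] sub in auto)
      show "V \<inter> lower (Suc m) \<subseteq> span (insert u (V \<inter> lower m))"
      proof
        fix x assume x: "x \<in> V \<inter> lower (Suc m)"
        have "x - scale (coord x m) u \<in> V \<inter> lower (Suc m)"
          using x u sub by (meson IntI subspace_diff subspace_scale)
        moreover have "coord (x - scale (coord x m) u) m = 0"
          using u by (simp add: coord_diff coord_scale)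
        ultimately have "x - scale (coord x m) u \<in> V \<inter> lower m"
          using lower_Suc_iff[OF m] by auto
        then have "x - scale (coord x m) u \<in> span (V \<inter> lower m)" by (rule span_base)
        then show "x \<in> span (insert u (V \<inter> lower m))"
          using span_breakdown_eq by blast
      qed
    qed
    moreover have "u \<notin> span (V \<inter> lower m)"
      using sub[of m] u lower_Suc_iff[OF m, of u] by (auto simp: span_eq_iff[THEN iffD2])
    ultimately have "dim (V \<inter> lower (Suc m)) = dim (V \<inter> lower m) + 1"
      using dim_insert[of u "V \<inter> lower m"] by (metis dim_span)
    moreover have "{i \<in> leading V. i < Suc m} = insert m {i \<in> leading V. i < m}"
      using True by (auto simp: less_Suc_eq)
    ultimately show ?thesis using Suc finite_leading by simp
  qed
qed

lemma card_leading:
  assumes "subspace V"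
  shows "card (leading V) = dim V"
proof -
  have "{i \<in> leading V. i < 2 * n + 2} = leading V"
    using leading_le by (fastforce simp: less_Suc_eq_le)
  then show ?thesis using dim_inter_lower[OF assms order_refl] lower_UNIV[OF order_refl] by simp
qed

lemma leading_span_e:
  assumes "I \<subseteq> {0..2 * n + 1}"
  shows "leading (span (e ` I)) = I"
proof (intro Set.set_eqI iffI)
  fix i assume "i \<in> leading (span (e ` I))"
  then obtain x where "i \<le> 2 * n + 1" "x \<in> span (e ` I)" "coord x i \<noteq> 0"
    using leading_vector[OF subspace_span] leading_subset
    by (metis atLeastAtMost_iff subsetD zero_neq_one)
  then show "i \<in> I" using in_span_e_iff[OF assms] by auto
next
  fix i assume i: "i \<in> I"
  then have "i \<le> 2 * n + 1" using assms by auto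
  then have "e i \<in> lower (Suc i)" "e i \<notin> lower i"
    using e_in_lower lower_Suc_iff[of i "e i"] by (auto simp: coord_e)
  then show "i \<in> leading (span (e ` I))"
    using i \<open>i \<le> 2 * n + 1\<close> unfolding leading_def by (auto intro: span_base)
qed

text \<open>
  The dimensions prescribed in the definition of a cell count the leading positions up to each
  \<open>i\<close>; such counts determine a set of indices, one element at a time.
\<close>

lemma schubert_cell_eq:
  assumes "I \<subseteq> {0..2 * n + 1}"
  shows "schubert_cell k I = {V \<in> isotropic_grassmannian \<omega>' k UNIV. leading V = I}"
proof -
  have "(\<forall>i\<le>2 * n + 1. dim (V \<inter> F i) = card {j \<in> I. j \<le> i}) \<longleftrightarrow> leading V = I"
    if "V \<in> isotropic_grassmannian \<omega>' k UNIV" for V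
  proof -
    have "subspace V" using that unfolding isotropic_grassmannian_def by simp
    then have dim: "dim (V \<inter> F i) = card {j \<in> leading V. j \<le> i}" if "i \<le> 2 * n + 1" for i
      using dim_inter_lower[of V "Suc i"] that by (simp add: F_eq_lower less_Suc_eq_le)
    have "leading V = I" if cards: "\<forall>i\<le>2 * n + 1. card {j \<in> leading V. j \<le> i} = card {j \<in> I. j \<le> i}"
    proof -
      have "i \<in> leading V \<longleftrightarrow> i \<in> I" for i
      proof (induction i rule: less_induct)
        case (less i)
        show ?case
        proof (cases "i \<le> 2 * n + 1")
          case True
          have split: "card {j \<in> J. j \<le> i} = card {j \<in> J. j < i} + (if i \<in> J then 1 else 0)" for J
          proof -
            have "{j \<in> J. j \<le> i} = (if i \<in> J then insert i {j \<in> J. j < i} else {j \<in> J. j < i})"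
              by (auto simp: le_less)
            then show ?thesis by simp
          qed
          have "{j \<in> leading V. j < i} = {j \<in> I. j < i}" using less by auto
          then show ?thesis using cards True split[of "leading V"] split[of I] by (auto split: if_splits)
        next
          case False
          then show ?thesis using assms leading_subset[of V] by (meson atLeastAtMost_iff subsetD)
        qed
      qed
      then show ?thesis by blast
    qed
    then show ?thesis using dim by auto
  qed
  then show ?thesis unfolding schubert_cell_def by auto
qed

text \<open>
  Vectors of \<open>V\<close> leading at \<open>i\<close> and at \<open>dual i\<close> would pair like \<open>e i\<close> and \<open>e (dual i)\<close>.
\<close>

lemma leading_isotropic:
  assumes "V \<in> isotropic_grassmannian \<omega>' k UNIV" "i \<in> leading V"
  shows "dual i \<notin> leading V"
proof
  assume "dual i \<in> leading V"
  have V: "subspace V" "\<And>x y. x \<in> V \<Longrightarrow> y \<in> V \<Longrightarrow> \<omega>' x y = 0"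
    using assms(1) unfolding isotropic_grassmannian_def by auto
  have i: "i \<le> 2 * n + 1" using assms(2) by (rule leading_le)
  obtain v where v: "v \<in> V" "v \<in> lower (Suc i)" "coord v i = 1"
    using leading_vector[OF V(1) assms(2)] .
  obtain w where w: "w \<in> V" "w \<in> lower (Suc (dual i))" "coord w (dual i) = 1"
    using leading_vector[OF V(1) \<open>dual i \<in> leading V\<close>] .
  have "\<omega>' v w = \<omega>' (e i) (e (dual i))" using form_leading[OF i v(2) w(2)] v w by simp
  then show False using V(2)[OF v(1) w(1)] form_e_dual_nonzero[OF i] by simp
qed

lemma admissible_iff:
  "admissible k I \<longleftrightarrow> I \<subseteq> {0..2 * n + 1} \<and> card I = k \<and> (\<forall>i\<in>I. dual i \<notin> I)"
proof -
  have "(\<forall>i\<le>n. \<not> (i \<in> I \<and> 2 * n + 1 - i \<in> I)) \<longleftrightarrow> (\<forall>i\<in>I. dual i \<notin> I)" if "I \<subseteq> {0..2 * n + 1}"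
  proof
    assume *: "\<forall>i\<le>n. \<not> (i \<in> I \<and> 2 * n + 1 - i \<in> I)"
    show "\<forall>i\<in>I. dual i \<notin> I"
    proof
      fix i assume "i \<in> I"
      then have "i \<le> 2 * n + 1" using that by auto
      then show "dual i \<notin> I"
        using *[rule_format, of i] *[rule_format, of "dual i"] \<open>i \<in> I\<close> dual_dual[of i]
        by (cases "i \<le> n") (auto simp: dual_def)
    qed
  qed (auto simp: dual_def)
  then show ?thesis unfolding admissible_def by blast
qed

lemma admissible_leading:
  "V \<in> isotropic_grassmannian \<omega>' k UNIV \<Longrightarrow> admissible k (leading V)"
  unfolding admissible_iff using leading_subset leading_isotropic card_leading
  by (auto simp: isotropic_grassmannian_def)

lemma span_e_isotropic:
  assumes "admissible k I"
  shows "span (e ` I) \<in> isotropic_grassmannian \<omega>' k UNIV"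
proof -
  have I: "I \<subseteq> {0..2 * n + 1}" "card I = k" "\<And>i. i \<in> I \<Longrightarrow> dual i \<notin> I"
    using assms unfolding admissible_iff by auto
  have "\<omega>' x y = 0" if "x \<in> span (e ` I)" "y \<in> span (e ` I)" for x y
  proof -
    have "coord x i * \<omega>' (e i) y = 0" if "i \<le> 2 * n + 1" for i
      using that I(3)[of i] \<open>x \<in> _\<close> \<open>y \<in> _\<close> form_e_left[OF that, of y]
      dual_le[of i]
      by (cases "i \<in> I") (auto simp: in_span_e_iff[OF I(1)] simp del: dual_le_Suc)
    then show ?thesis
      by (subst coord_expansion[of x]) (simp add: form_sum form_scale del: mult_eq_0_iff sum.atMost_Suc)
  qed
  moreover have "dim (span (e ` I)) = k"
    using card_leading[OF subspace_span] leading_span_e[OF I(1)] I(2) by metis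
  ultimately show ?thesis unfolding isotropic_grassmannian_def by simp
qed

text \<open>
  Gauss elimination from the top position downwards. Below, \<open>w\<close> will be a vector of \<open>V\<close> leading at
  \<open>m\<close>, and subtracting \<open>u\<close> leaves its leading term alone.
\<close>

lemma echelon_reduction:
  assumes "subspace V"
  shows "\<exists>u \<in> V \<inter> lower m. \<forall>j\<in>leading V. j < m \<longrightarrow> coord (w - u) j = 0"
proof (induction m arbitrary: w)
  case 0
  then show ?case using subspace_0[OF assms] subspace_0[OF subspace_lower] by auto
next
  case (Suc m)
  show ?case
  proof (cases "m \<in> leading V")
    case False
    then show ?thesis using Suc[of w] lower_mono[of m "Suc m"] by (fastforce simp: less_Suc_eq)
  next
    case True
    obtain v where v: "v \<in> V" "v \<in> lower (Suc m)" "coord v m = 1"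
      using leading_vector[OF assms True] .
    have m: "m \<le> 2 * n + 1" using True by (rule leading_le)
    obtain u where u: "u \<in> V \<inter> lower m"
      "\<forall>j\<in>leading V. j < m \<longrightarrow> coord (w - scale (coord w m) v - u) j = 0"
      using Suc by blast
    have "u + scale (coord w m) v \<in> V \<inter> lower (Suc m)"
      using u v assms subspace_lower lower_mono[of m "Suc m"]
      by (auto intro!: subspace_add subspace_scale)
    moreover have "coord (w - (u + scale (coord w m) v)) j = 0"
      if "j \<in> leading V" "j < Suc m" for j
    proof (cases "j = m")
      case True
      then show ?thesis using u(1) v lower_Suc_iff[OF m, of u]
        by (simp add: coord_add coord_diff coord_scale)
    next
      case False
      then show ?thesis using u(2) that by (simp add: coord_add coord_diff coord_scale algebra_simps)
    qed
    ultimately show ?thesis by blast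
  qed
qed

text \<open>
  The \<open>i\<close>-th vector of the reduced echelon basis of \<open>V\<close>, split into its leading term and the rest.
\<close>

lemma reduced_vector:
  assumes "subspace V" "i \<in> leading V"
  shows "\<exists>w. e i + w \<in> V \<and> w \<in> lower i \<and> (\<forall>j\<in>leading V. coord w j = 0)"
proof -
  have i: "i \<le> 2 * n + 1" using assms(2) by (rule leading_le)
  obtain v where v: "v \<in> V" "v \<in> lower (Suc i)" "coord v i = 1"
    using leading_vector[OF assms] .
  obtain u where u: "u \<in> V" "u \<in> lower i" "\<And>j. j \<in> leading V \<Longrightarrow> j < i \<Longrightarrow> coord (v - u) j = 0"
    using echelon_reduction[OF assms(1), of i v] by blast
  have ui: "coord u i = 0" "u \<in> lower (Suc i)" using lower_Suc_iff[OF i] u by auto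
  have "v - u - e i \<in> lower (Suc i)"
    using v ui e_in_lower[OF i] subspace_lower by (auto intro!: subspace_diff)
  then have low: "v - u - e i \<in> lower i"
    using v ui i by (subst lower_Suc_iff) (auto simp: coord_diff coord_e)
  moreover have "coord (v - u - e i) j = 0" if "j \<in> leading V" for j
  proof (cases "j < i")
    case True
    then show ?thesis using u(3)[OF that] i by (simp add: coord_diff coord_e)
  next
    case False
    then show ?thesis using low that leading_subset[of V] unfolding lower_def by auto
  qed
  moreover have "e i + (v - u - e i) \<in> V" using u v assms(1) by (simp add: subspace_diff)
  ultimately show ?thesis by blast
qed

section \<open>Isometries preserving the flag\<close>

lemma linI:
  assumes "\<And>x y. T (x + y) = T x + T y" "\<And>c x. T (scale c x) = scale c (T x)"
  shows "lin T"
  unfolding Vector_Spaces.linear_iff using assms vector_space_axioms by blast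

definition flag_isometry :: "('v \<Rightarrow> 'v) \<Rightarrow> bool" where
  "flag_isometry T \<longleftrightarrow>
     lin T \<and> (\<forall>x y. \<omega>' (T x) (T y) = \<omega>' x y) \<and> (\<forall>m. T ` lower m = lower m)"

lemma image_lower_eq:
  assumes "lin T" "inj_on T (lower m)" "T ` lower m \<subseteq> lower m"
  shows "T ` lower m = lower m"
proof (rule subspace_dim_equal)
  interpret T: Vector_Spaces.linear scale scale T by fact
  show "subspace (T ` lower m)" using subspace_lower by (rule T.subspace_image)
  have "span (lower m) = lower m" using subspace_lower span_eq_iff by blast
  then show "dim (lower m) \<le> dim (T ` lower m)"
    using endo.dim_image_eq[OF assms(1), of "lower m"] assms(2) by (metis order_refl)
qed (use assms subspace_lower in auto)

text \<open>A vector killed by a form-preserving map pairs to zero with everything.\<close>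

lemma isometry_inj:
  assumes "lin T" "\<And>x y. \<omega>' (T x) (T y) = \<omega>' x y"
  shows "inj T"
proof -
  interpret T: Vector_Spaces.linear scale scale T by fact
  show ?thesis
  proof (subst T.inj_iff_eq_0, intro allI impI)
    fix x assume "T x = 0"
    then have "\<omega>' x y = 0" for y using assms(2)[of x y] by simp
    then show "x = 0" by (rule form_nondegenerate)
  qed
qed

lemma flag_isometryI:
  assumes "lin T" "\<And>x y. \<omega>' (T x) (T y) = \<omega>' x y" "\<And>m. T ` lower m \<subseteq> lower m"
  shows "flag_isometry T"
  unfolding flag_isometry_def
  using assms image_lower_eq isometry_inj by (meson inj_on_subset subset_UNIV)

lemma flag_isometry_bij:
  assumes "flag_isometry T"
  shows "bij T"
proof -
  have "T ` UNIV = UNIV" using assms lower_UNIV[of "2 * n + 2"] unfolding flag_isometry_def by force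
  moreover have "inj T" using assms isometry_inj unfolding flag_isometry_def by blast
  ultimately show ?thesis by (simp add: bij_def)
qed

lemma flag_isometry_compose:
  assumes "flag_isometry S" "flag_isometry T"
  shows "flag_isometry (S \<circ> T)"
  using assms Vector_Spaces.linear_compose[of scale scale T scale S] unfolding flag_isometry_def
  by (simp only: image_comp[symmetric] comp_apply simp_thms)

lemma flag_isometry_inv:
  assumes "flag_isometry T"
  shows "flag_isometry (inv_into UNIV T)"
proof -
  have T: "bij T" "lin T" "\<And>x y. \<omega>' (T x) (T y) = \<omega>' x y" "\<And>m. T ` lower m = lower m"
    using flag_isometry_bij assms unfolding flag_isometry_def by auto
  interpret T: Vector_Spaces.linear scale scale T by fact
  have inv: "T (inv_into UNIV T x) = x" "inv_into UNIV T (T x) = x" for x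
    using T(1) by (simp_all add: bij_is_surj surj_f_inv_f bij_is_inj)
  have "lin (inv_into UNIV T)"
    by (rule linI) (use inv T.add T.scale in metis)+
  moreover have "\<omega>' (inv_into UNIV T x) (inv_into UNIV T y) = \<omega>' x y" for x y
    using T(3)[of "inv_into UNIV T x" "inv_into UNIV T y"] inv by simp
  moreover have "inv_into UNIV T ` lower m = lower m" for m
    using T(1,4) by (metis bij_is_inj image_inv_f_f)
  ultimately show ?thesis unfolding flag_isometry_def by simp
qed

definition frame_map :: "(nat \<Rightarrow> 'v) \<Rightarrow> 'v \<Rightarrow> 'v" where
  "frame_map f x = (\<Sum>i\<le>2 * n + 1. scale (coord x i) (f i))"

lemma linear_frame_map: "lin (frame_map f)"
  by (rule linI) (simp_all add: frame_map_def coord_add coord_scale scale_left_distrib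
      sum.distrib scale_sum_right del: sum.atMost_Suc)

lemma frame_map_e: "i \<le> 2 * n + 1 \<Longrightarrow> frame_map f (e i) = f i"
proof -
  assume i: "i \<le> 2 * n + 1"
  have "frame_map f (e i) = (\<Sum>j\<le>2 * n + 1. if j = i then f j else 0)"
    unfolding frame_map_def by (rule sum.cong) (use i in \<open>auto simp: coord_e\<close>)
  then show ?thesis using i by simp
qed

lemma frame_map_lower:
  assumes "\<And>i. i < m \<Longrightarrow> i \<le> 2 * n + 1 \<Longrightarrow> f i \<in> lower (Suc i)" "x \<in> lower m"
  shows "frame_map f x \<in> lower m"
  unfolding frame_map_def
proof (rule subspace_sum[OF subspace_lower])
  fix i assume i: "i \<in> {..2 * n + 1}"
  show "scale (coord x i) (f i) \<in> lower m"
  proof (cases "i < m")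
    case True
    then have "f i \<in> lower m" using assms(1)[of i] i lower_mono[of "Suc i" m] by auto
    then show ?thesis using subspace_lower subspace_scale by blast
  next
    case False
    then have "coord x i = 0" using assms(2) i unfolding lower_def by auto
    then show ?thesis using subspace_0[OF subspace_lower] by simp
  qed
qed

lemma flag_isometry_frame_map:
  assumes "\<And>i. i \<le> 2 * n + 1 \<Longrightarrow> f i \<in> lower (Suc i)"
    and "\<And>i j. i \<le> 2 * n + 1 \<Longrightarrow> j \<le> 2 * n + 1 \<Longrightarrow> \<omega>' (f i) (f j) = \<omega>' (e i) (e j)"
  shows "flag_isometry (frame_map f)"
proof (rule flag_isometryI)
  fix x y
  have "\<omega>' (frame_map f x) (frame_map f y) =
    (\<Sum>i\<le>2 * n + 1. coord x i * (\<Sum>j\<le>2 * n + 1. coord y j * \<omega>' (f i) (f j)))"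
    unfolding frame_map_def by (simp only: form_sum(1) form_scale(1), simp only: form_sum(2) form_scale(2))
  also have "\<dots> = (\<Sum>i\<le>2 * n + 1. coord x i * (\<Sum>j\<le>2 * n + 1. coord y j * \<omega>' (e i) (e j)))"
    using assms(2) by (intro sum.cong arg_cong2[where f="(*)"]) auto
  also have "\<dots> = \<omega>' (\<Sum>i\<le>2 * n + 1. scale (coord x i) (e i)) (\<Sum>j\<le>2 * n + 1. scale (coord y j) (e j))"
    by (simp only: form_sum(1) form_scale(1), simp only: form_sum(2) form_scale(2))
  also have "\<dots> = \<omega>' x y" using coord_expansion by simp
  finally show "\<omega>' (frame_map f x) (frame_map f y) = \<omega>' x y" .
qed (use assms linear_frame_map frame_map_lower in auto)

text \<open>
  The symplectic basis adapted at once to the flag and to \<open>V\<close>. In the proof, \<open>u j\<close> is the correction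
  to \<open>e j\<close> for \<open>j\<close> outside \<open>I\<close>. Everything rests on three pairings: the corrections are orthogonal to
  each other and to every \<open>e j\<close> with \<open>j\<close> outside \<open>I\<close>, and \<open>u j\<close> pairs with the \<open>l\<close>-th echelon vector
  exactly as \<open>e j\<close> pairs with its tail \<open>w l\<close>.
\<close>

lemma coordinate_subspace_transport:
  assumes V: "V \<in> isotropic_grassmannian \<omega>' k UNIV"
  obtains T where "flag_isometry T" "T ` span (e ` leading V) = V"
proof -
  define I where "I = leading V"
  have adm: "admissible k I" using admissible_leading[OF V] unfolding I_def .
  then have I: "I \<subseteq> {0..2 * n + 1}" "finite I" "\<And>i. i \<in> I \<Longrightarrow> dual i \<notin> I"
    using finite_leading unfolding admissible_iff I_def by auto
  have subV: "subspace V" and dimV: "dim V = k" and isoV: "\<And>x y. x \<in> V \<Longrightarrow> y \<in> V \<Longrightarrow> \<omega>' x y = 0"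
    using V unfolding isotropic_grassmannian_def by auto
  have "\<exists>w. \<forall>i\<in>I. e i + w i \<in> V \<and> w i \<in> lower i \<and> (\<forall>j\<in>I. coord (w i) j = 0)"
    using reduced_vector[OF subV] unfolding I_def by (intro bchoice) blast
  then obtain w where w: "\<And>i. i \<in> I \<Longrightarrow> e i + w i \<in> V" "\<And>i. i \<in> I \<Longrightarrow> w i \<in> lower i"
    "\<And>i j. i \<in> I \<Longrightarrow> j \<in> I \<Longrightarrow> coord (w i) j = 0" by blast
  define c where "c j i = \<omega>' (e j) (w i) / \<omega>' (e (dual i)) (e i)" for j i
  define u where "u j = (\<Sum>i\<in>I. scale (c j i) (e (dual i)))" for j
  define f where "f j = (if j \<in> I then e j + w j else e j - u j)" for j
  have Ile: "i \<le> 2 * n + 1" if "i \<in> I" for i using that I by auto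
  have low: "f j \<in> lower (Suc j)" if j: "j \<le> 2 * n + 1" for j
  proof (cases "j \<in> I")
    case True
    then show ?thesis using w(2)[OF True] e_in_lower[OF j] lower_mono[of j "Suc j"] subspace_lower
      unfolding f_def by (auto intro!: subspace_add)
  next
    case False
    have "scale (c j i) (e (dual i)) \<in> lower (Suc j)" if i: "i \<in> I" for i
    \<comment> \<open>For \<open>dual i > j\<close> the basis vector leaves the flag step, but then its coefficient is zero,
      because \<open>w i\<close> has no coordinate at \<open>dual j \<ge> i\<close>.\<close>
    proof (cases "dual i \<le> j")
      case True
      then have "e (dual i) \<in> lower (Suc j)"
        using e_in_lower[OF dual_le, of i] lower_mono[of "Suc (dual i)" "Suc j"] by auto
      then show ?thesis using subspace_lower subspace_scale by blast
    next
      case False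
      then have "i \<le> dual j" using Ile[OF i] j by (auto simp: dual_def)
      then have "coord (w i) (dual j) = 0" using w(2)[OF i] unfolding lower_def by auto
      then have "c j i = 0" using form_e_left[OF j, of "w i"] unfolding c_def by simp
      then show ?thesis using subspace_0[OF subspace_lower] by simp
    qed
    then have "u j \<in> lower (Suc j)" unfolding u_def by (intro subspace_sum[OF subspace_lower])
    then show ?thesis using False e_in_lower[OF j] subspace_lower
      unfolding f_def by (auto intro!: subspace_diff)
  qed
  have e_u: "\<omega>' (e j) (u l) = 0" if "j \<le> 2 * n + 1" "j \<notin> I" for j l
    unfolding u_def form_sum form_scale
  proof (rule sum.neutral, rule ballI)
    fix i assume i: "i \<in> I"
    then have "dual i \<noteq> dual j" using that Ile dual_dual by metis
    then show "c l i * \<omega>' (e j) (e (dual i)) = 0" using that form_e_eq_0 by simp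
  qed
  have u_u: "\<omega>' (u j) (u l) = 0" for j l
    by (subst u_def) (auto simp: form_sum form_scale intro!: sum.neutral e_u I(3))
  have u_I: "\<omega>' (u j) (e l + w l) = \<omega>' (e j) (w l)" if l: "l \<in> I" for j l
  proof -
    have "\<omega>' (u j) (e l + w l) = (\<Sum>i\<in>I. c j i * \<omega>' (e (dual i)) (e l + w l))"
      unfolding u_def form_sum form_scale ..
    also have "\<dots> = (\<Sum>i\<in>I. if i = l then \<omega>' (e j) (w l) else 0)"
    proof (rule sum.cong)
      fix i assume i: "i \<in> I"
      \<comment> \<open>This pairing reads off the \<open>i\<close>-th coordinate, which is zero for \<open>i \<noteq> l\<close> in a reduced basis.\<close>
      have "\<omega>' (e (dual i)) (e l + w l) = (if i = l then \<omega>' (e (dual i)) (e i) else 0)"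
        using form_e_left[OF dual_le, of i "e l + w l"] w(3)[OF l i] Ile[OF i] Ile[OF l]
        by (simp add: coord_add coord_e)
      moreover have "\<omega>' (e (dual i)) (e i) \<noteq> 0"
        using form_e_dual_nonzero[OF dual_le, of i] Ile[OF i] by simp
      ultimately show "c j i * \<omega>' (e (dual i)) (e l + w l) = (if i = l then \<omega>' (e j) (w l) else 0)"
        unfolding c_def by auto
    qed simp
    finally show ?thesis using l I(2) by simp
  qed
  have mixed: "\<omega>' (f j) (f l) = \<omega>' (e j) (e l)" if "j \<le> 2 * n + 1" "j \<notin> I" "l \<in> I" for j l
    using that u_I[OF that(3), of j] unfolding f_def by (simp add: form_diff) (simp add: form_add)
  have gram: "\<omega>' (f j) (f l) = \<omega>' (e j) (e l)" if jl: "j \<le> 2 * n + 1" "l \<le> 2 * n + 1" for j l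
  proof -
    consider "j \<in> I" "l \<in> I" | "j \<notin> I" "l \<notin> I" | "j \<notin> I" "l \<in> I" | "j \<in> I" "l \<notin> I" by blast
    then show ?thesis
    proof cases
      case 1
      then have "\<omega>' (e j) (e l) = 0" using I(3) form_e_eq_0 jl by metis
      then show ?thesis using 1 isoV w(1) unfolding f_def by simp
    next
      case 2
      then show ?thesis using jl e_u u_u form_skew[of "u j" "e l"] unfolding f_def
        by (simp add: form_diff)
    next
      case 3
      then show ?thesis using mixed jl by simp
    next
      case 4
      then show ?thesis using mixed[of l j] jl form_skew[of "f j"] form_skew[of "e j"] by simp
    qed
  qed
  have iso: "flag_isometry (frame_map f)" using flag_isometry_frame_map low gram by blast
  interpret T: Vector_Spaces.linear scale scale "frame_map f" by (rule linear_frame_map)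
  have "frame_map f ` span (e ` I) = V"
  proof (rule subspace_dim_equal)
    show "subspace (frame_map f ` span (e ` I))" by (intro T.subspace_image subspace_span)
    have "frame_map f ` span (e ` I) = span (frame_map f ` e ` I)" by (simp add: T.span_image)
    also have "\<dots> \<subseteq> V"
      by (rule span_minimal[OF _ subV]) (use w(1) frame_map_e Ile in \<open>auto simp: f_def\<close>)
    finally show "frame_map f ` span (e ` I) \<subseteq> V" .
    have "inj (frame_map f)" using flag_isometry_bij[OF iso] by (rule bij_is_inj)
    then have "dim (frame_map f ` span (e ` I)) = dim (span (e ` I))"
      using endo.dim_image_eq[OF linear_frame_map] by (meson inj_on_subset subset_UNIV)
    also have "\<dots> = k" using span_e_isotropic[OF adm] unfolding isotropic_grassmannian_def by simp
    finally show "dim V \<le> dim (frame_map f ` span (e ` I))" using dimV by simp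
  qed (rule subV)
  then show thesis using iso that unfolding I_def by blast
qed

section \<open>Orbits of the Borel subgroup\<close>

lemma isotropic_E_iff:
  "V \<in> isotropic_grassmannian \<omega> k E \<longleftrightarrow> V \<in> isotropic_grassmannian \<omega>' k UNIV \<and> V \<subseteq> E"
  unfolding isotropic_grassmannian_def using extends by (auto simp: subset_eq)

lemma subset_E_iff: "V \<subseteq> E \<longleftrightarrow> 2 * n + 1 \<notin> leading V"
  unfolding leading_def E_eq_lower using lower_UNIV[of "Suc (2 * n + 1)"] by auto

lemma in_borel_iff:
  "g \<in> carrier (borel) \<longleftrightarrow> g \<in> Bij E \<and> linear_map_on E g \<and>
    (\<forall>x\<in>E. \<forall>y\<in>E. \<omega> (g x) (g y) = \<omega> x y) \<and> (\<forall>j\<le>2 * n. g (e j) \<in> lower (Suc j))"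
proof (cases "g \<in> Bij E")
  case True
  have mem: "g (e j) \<in> E" if "j \<le> 2 * n" for j
  proof -
    have "e j \<in> E" unfolding E_eq using that by (auto intro: span_base)
    then show ?thesis using Bij_imp_funcset[OF True] by auto
  qed
  have "(\<forall>i\<le>2 * n. \<forall>j<i. representation (e ` {0..2 * n}) (g (e j)) (e i) = 0) \<longleftrightarrow>
      (\<forall>j\<le>2 * n. g (e j) \<in> lower (Suc j))"
  proof
    assume *: "\<forall>i\<le>2 * n. \<forall>j<i. representation (e ` {0..2 * n}) (g (e j)) (e i) = 0"
    show "\<forall>j\<le>2 * n. g (e j) \<in> lower (Suc j)"
    proof (intro allI impI)
      fix j assume j: "j \<le> 2 * n"
      have "coord (g (e j)) i = 0" if i: "i \<le> 2 * n + 1" "Suc j \<le> i" for i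
      proof (cases "i \<le> 2 * n")
        case True
        then show ?thesis using *[rule_format, of i j] i coord_hyperplane[OF mem[OF j], of i] by simp
      next
        case False
        then have "i = 2 * n + 1" using i by simp
        then show ?thesis using mem[OF j] unfolding E_eq_lower lower_def by simp
      qed
      then show "g (e j) \<in> lower (Suc j)" unfolding lower_def by auto
    qed
  next
    assume *: "\<forall>j\<le>2 * n. g (e j) \<in> lower (Suc j)"
    show "\<forall>i\<le>2 * n. \<forall>j<i. representation (e ` {0..2 * n}) (g (e j)) (e i) = 0"
    proof (intro allI impI)
      fix i j assume "i \<le> 2 * n" "j < i"
      then show "representation (e ` {0..2 * n}) (g (e j)) (e i) = 0"
        using * mem[of j] by (subst coord_hyperplane) (auto simp: lower_def)
    qed
  qed
  then show ?thesis by (auto simp: borel_def Sp_on_def GL_on_def)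
qed (auto simp: borel_def Sp_on_def GL_on_def)

lemma restrict_flag_isometry_in_borel:
  assumes "flag_isometry T"
  shows "restrict T E \<in> carrier borel"
proof -
  have T: "lin T" "\<And>x y. \<omega>' (T x) (T y) = \<omega>' x y" "\<And>m. T ` lower m = lower m"
    using assms unfolding flag_isometry_def by auto
  interpret T: Vector_Spaces.linear scale scale T by fact
  have TE: "T ` E = E" using T(3) unfolding E_eq_lower .
  have "bij_betw T E E"
    using TE flag_isometry_bij[OF assms] by (metis bij_betw_subset subset_UNIV)
  then have "restrict T E \<in> Bij E" unfolding Bij_def by (simp add: bij_betw_def)
  moreover have "linear_map_on E (restrict T E)"
    using subspace_E unfolding linear_map_on_def
    by (auto simp: T.add T.scale subspace_add subspace_scale)
  moreover have "\<omega> (T x) (T y) = \<omega> x y" if "x \<in> E" "y \<in> E" for x y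
    using that TE T(2)[of x y] extends by (metis imageI)
  moreover have "T (e j) \<in> lower (Suc j)" "e j \<in> E" if "j \<le> 2 * n" for j
    using that T(3) e_in_lower[of j] E_eq by (auto intro: span_base)
  ultimately show ?thesis unfolding in_borel_iff by auto
qed

text \<open>
  Extending \<open>g\<close> to the ambient space makes the theory of linear maps applicable. The value at
  \<open>e (2 * n + 1)\<close> is that of \<open>g\<close> outside its domain, so the extension need be neither injective nor
  an isometry; only its behaviour on \<open>E\<close> matters.
\<close>

lemma borel_extension:
  assumes "g \<in> carrier borel"
  obtains T where "lin T" "\<And>x. x \<in> E \<Longrightarrow> T x = g x" "\<And>m. m \<le> 2 * n + 1 \<Longrightarrow> T ` lower m = lower m"
    "inj_on T E"
proof -
  have g: "g \<in> Bij E" "linear_map_on E g" "\<And>j. j \<le> 2 * n \<Longrightarrow> g (e j) \<in> lower (Suc j)"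
    using assms unfolding in_borel_iff by auto
  define T where "T = frame_map (\<lambda>i. g (e i))"
  have eE: "e j \<in> E" if "j \<le> 2 * n" for j unfolding E_eq using that by (auto intro: span_base)
  interpret T: Vector_Spaces.linear scale scale T unfolding T_def by (rule linear_frame_map)
  have "T x = g x \<and> x \<in> E" if "x \<in> span (e ` {0..2 * n})" for x
    using that
  proof (induction rule: span_induct_alt)
    case base
    have "g (scale 0 0) = scale 0 (g 0)"
      using g(2) subspace_0[OF subspace_E] unfolding linear_map_on_def by blast
    then show ?case using subspace_0[OF subspace_E] by simp
  next
    case (step c x y)
    then obtain j where j: "j \<le> 2 * n" "x = e j" by auto
    have E: "y \<in> E" "scale c x \<in> E" using step eE[OF j(1)] j subspace_E
      by (auto intro: subspace_scale)
    then have "g (scale c x + y) = scale c (g x) + g y"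
      using g(2) eE[OF j(1)] j(2) unfolding linear_map_on_def by simp
    moreover have "T x = g x" using j by (simp add: T_def frame_map_e)
    ultimately show ?case using step E subspace_E by (simp add: T.add T.scale subspace_add)
  qed
  then have T0: "T x = g x" if "x \<in> E" for x using that unfolding E_eq by blast
  have inj: "inj_on T E"
    using g(1) T0 unfolding Bij_def bij_betw_def by (auto simp: inj_on_def)
  have "T ` lower m = lower m" if m: "m \<le> 2 * n + 1" for m
  proof (rule image_lower_eq)
    show "lin T" by (rule T.linear_axioms)
    show "inj_on T (lower m)"
      using inj lower_mono[OF m] unfolding E_eq_lower by (rule inj_on_subset)
    show "T ` lower m \<subseteq> lower m" unfolding T_def
      using g(3) m frame_map_lower[of m "\<lambda>i. g (e i)"] by auto
  qed
  then show thesis using that T0 inj T.linear_axioms by blast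
qed

lemma borel_image:
  assumes g: "g \<in> carrier borel" and V: "V \<in> isotropic_grassmannian \<omega> k E"
  shows "g ` V \<in> isotropic_grassmannian \<omega> k E" "leading (g ` V) = leading V"
proof -
  obtain T where T: "lin T" "\<And>x. x \<in> E \<Longrightarrow> T x = g x"
      "\<And>m. m \<le> 2 * n + 1 \<Longrightarrow> T ` lower m = lower m" "inj_on T E"
    using borel_extension[OF g] by metis
  interpret T: Vector_Spaces.linear scale scale T by fact
  have VE: "V \<subseteq> E" and sub: "subspace V" and dim: "dim V = k"
    and iso: "\<And>x y. x \<in> V \<Longrightarrow> y \<in> V \<Longrightarrow> \<omega> x y = 0"
    using V unfolding isotropic_grassmannian_def by auto
  have gV: "g ` V = T ` V" using T(2) VE by (auto intro!: image_cong)
  have TE: "T ` E = E" using T(3) unfolding E_eq_lower by simp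
  have "dim (T ` V) = k"
    using endo.dim_image_eq[OF T(1), of V] sub dim T(4) VE
    by (metis inj_on_subset span_eq_iff)
  moreover have "\<omega> (g x) (g y) = 0" if "x \<in> V" "y \<in> V" for x y
    using that g VE[THEN subsetD] iso[OF that] unfolding in_borel_iff by metis
  moreover have "subspace (g ` V)" "g ` V \<subseteq> E"
    using T.subspace_image[OF sub] image_mono[OF VE, of T] TE gV by simp_all
  ultimately show "g ` V \<in> isotropic_grassmannian \<omega> k E"
    unfolding isotropic_grassmannian_def gV[symmetric] by blast
  \<comment> \<open>Injectivity on \<open>E\<close> turns preservation of a flag step into an equivalence.\<close>
  have pres: "T x \<in> lower m \<longleftrightarrow> x \<in> lower m" if "x \<in> E" for x m
  proof (cases "m \<le> 2 * n + 1")
    case True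
    have "lower m \<subseteq> E" using lower_mono[OF True] unfolding E_eq_lower .
    then show ?thesis using inj_on_image_mem_iff[OF T(4) that] T(3)[OF True] by metis
  next
    case False
    then show ?thesis using lower_UNIV by simp
  qed
  have "T ` V \<inter> lower (Suc i) \<subseteq> lower i \<longleftrightarrow> V \<inter> lower (Suc i) \<subseteq> lower i" for i
    using pres[OF VE[THEN subsetD]] by blast
  then show "leading (g ` V) = leading V"
    unfolding leading_def gV by simp
qed

text \<open>
  Both \<open>V\<close> and any \<open>W\<close> in its cell are images of the same coordinate subspace under flag
  isometries, so going back along one and forth along the other carries \<open>V\<close> to \<open>W\<close>.
\<close>

lemma orbit_borel:
  assumes V: "V \<in> isotropic_grassmannian \<omega> k E"
  shows "orbit borel (act k) V = schubert_cell k (leading V)"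
proof (rule Set.set_eqI, rule iffI)
  fix W assume "W \<in> orbit borel (act k) V"
  then obtain g where "g \<in> carrier borel" "W = g ` V"
    using V unfolding orbit_def act_def by auto
  then show "W \<in> schubert_cell k (leading V)"
    using borel_image[OF _ V, of g] isotropic_E_iff schubert_cell_eq[OF leading_subset] by auto
next
  fix W assume "W \<in> schubert_cell k (leading V)"
  then have W: "W \<in> isotropic_grassmannian \<omega>' k UNIV" "leading W = leading V"
    using schubert_cell_eq[OF leading_subset] by auto
  obtain S where S: "flag_isometry S" "S ` span (e ` leading V) = V"
    using coordinate_subspace_transport V isotropic_E_iff by blast
  obtain T where T: "flag_isometry T" "T ` span (e ` leading V) = W"
    using coordinate_subspace_transport[OF W(1)] W(2) by metis
  define R where "R = T \<circ> inv_into UNIV S"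
  have "R ` V = W"
    using S(2) T(2) flag_isometry_bij[OF S(1)] unfolding R_def
    by (metis bij_is_inj image_comp image_inv_f_f)
  moreover have "restrict R E ` V = R ` V"
    using V unfolding isotropic_grassmannian_def by (auto intro!: image_cong)
  moreover have "restrict R E \<in> carrier borel"
    unfolding R_def using S(1) T(1)
    by (intro restrict_flag_isometry_in_borel flag_isometry_compose flag_isometry_inv)
  ultimately have "act k (restrict R E) V = W" "restrict R E \<in> carrier borel"
    using V unfolding act_def by (simp_all only: restrict_apply if_True)
  then show "W \<in> orbit borel (act k) V"
    unfolding orbit_def by blast
qed

text \<open>
  A cell inside the odd symplectic grassmannian is an orbit because it is nonempty: it contains its
  coordinate subspace. An orbit is a whole cell, and this cell stays inside \<open>E\<close> because lying in
  \<open>E\<close> is visible from the leading positions.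
\<close>

lemma odd_schubert_cells_eq_orbits:
  "odd_schubert_cells k = orbits borel (isotropic_grassmannian \<omega> k E) (act k)"
proof (rule Set.set_eqI, rule iffI)
  fix C assume "C \<in> odd_schubert_cells k"
  then obtain I where I: "admissible k I" "C = schubert_cell k I"
    and C: "C \<subseteq> isotropic_grassmannian \<omega> k E"
    unfolding odd_schubert_cells_def by auto
  have sub: "I \<subseteq> {0..2 * n + 1}" using I unfolding admissible_iff by auto
  have "span (e ` I) \<in> C"
    using I span_e_isotropic leading_span_e[OF sub] by (simp add: schubert_cell_eq[OF sub])
  then have "span (e ` I) \<in> isotropic_grassmannian \<omega> k E" using C by blast
  moreover from this have "orbit borel (act k) (span (e ` I)) = C"
    using orbit_borel leading_span_e[OF sub] I(2) by metis
  ultimately show "C \<in> orbits borel (isotropic_grassmannian \<omega> k E) (act k)"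
    unfolding orbits_def by blast
next
  fix C assume "C \<in> orbits borel (isotropic_grassmannian \<omega> k E) (act k)"
  then obtain V where V: "V \<in> isotropic_grassmannian \<omega> k E" and C: "C = orbit borel (act k) V"
    unfolding orbits_def by auto
  have "admissible k (leading V)" using V isotropic_E_iff admissible_leading by auto
  moreover have "W \<in> isotropic_grassmannian \<omega> k E" if "W \<in> schubert_cell k (leading V)" for W
    using that V unfolding schubert_cell_eq[OF leading_subset] isotropic_E_iff subset_E_iff by simp
  ultimately show "C \<in> odd_schubert_cells k"
    unfolding odd_schubert_cells_def C orbit_borel[OF V] by blast
qed

end

theorem proposition4p13:
  fixes scale :: "complex \<Rightarrow> 'v::ab_group_add \<Rightarrow> 'v"
    and n k :: nat
    and E :: "'v set"
    and \<omega> \<omega>' :: "'v \<Rightarrow> 'v \<Rightarrow> complex"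
    and e :: "nat \<Rightarrow> 'v"
  assumes "odd_symplectic scale n E \<omega> \<omega>' e"
    and "1 \<le> k"
    and "k \<le> n + 1"
  shows "odd_symplectic.odd_schubert_cells scale n E \<omega> \<omega>' e k =
    orbits (odd_symplectic.borel scale n E \<omega> e)
      (complex_vector_space.isotropic_grassmannian scale \<omega> k E)
      (odd_symplectic.act scale E \<omega> k)"
  using odd_symplectic.odd_schubert_cells_eq_orbits[OF assms(1)] .

end
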